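(* Let $A$ be a uniform algebra on a compact Hausdorff space and let $X$ be a singly generated (left) operator module over $A$. Then $X$ is $A$-Hilbertian if and only if $X$ is $A$-rigged.
   Context: A uniform algebra on a compact Hausdorff space $\Omega$ is a closed subalgebra of $C(\Omega)$ (complex continuous functions) which contains the constants and separates points; it carries the operator space structure inherited from $C(\Omega)$. A left operator module over $A$ is a complete operator space $X$ which is a unital left $A$-module with $\|[\sum_k a_{ik}x_{kj}]\|\le\|[a_{ij}]\|\|[x_{ij}]\|$ for all matrices over $A$ and $X$. $X$ is singly generated if there is $x\in X$ with $Ax$ dense in $X$. $R_n(A)$ is $A^{(n)}$ (the space of $n$-tuples) with the operator space structure of the first row of $M_n(A)$. $X$ is $A$-Hilbertian if there exist a net of natural numbers $n_\alpha$ and completely contractive $A$-module maps $\phi_\alpha:X\to R_{n_\alpha}(A)$ and $\psi_\alpha:R_{n_\alpha}(A)\to X$ such that $\psi_\alpha(\phi_\alpha(x))\to x$ for all $x\in X$. $X$ is $A$-rigged if such nets can be chosen with the additional property that, for every $\beta$, $\phi_\beta\circ\psi_\alpha\circ\phi_\alpha\to\phi_\beta$ in completely bounded norm (limit in $\alpha$). *)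

theory Defs
  imports "HOL-Analysis.Analysis" "HOL-Library.Function_Algebras"
begin

text \<open>
  Matrices over a space are functions \<open>nat \<Rightarrow> nat \<Rightarrow> _\<close> together with explicit sizes; only
  the entries with indices below the sizes count.  Algebraic operations on functions are the
  pointwise ones of \<^theory>\<open>HOL-Library.Function_Algebras\<close>.
\<close>

section \<open>Matrix norms over the complex numbers\<close>

text \<open>Norm of an \<open>m\<close> by \<open>n\<close> complex matrix as an operator between Euclidean spaces.\<close>

definition op_norm :: "nat \<Rightarrow> nat \<Rightarrow> (nat \<Rightarrow> nat \<Rightarrow> complex) \<Rightarrow> real" where
  "op_norm m n a =
     Sup {L2_set (\<lambda>i. cmod (\<Sum>j<n. a i j * v j)) {..<m} | v.
            L2_set (\<lambda>j. cmod (v j)) {..<n} \<le> 1}"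

section \<open>Uniform algebras\<close>

locale uniform_algebra =
  fixes A :: "('t::t2_space \<Rightarrow> complex) set"
  assumes compact_domain: "compact (UNIV :: 't set)"
    and continuous: "f \<in> A \<Longrightarrow> continuous_on UNIV f"
    and const_mem: "(\<lambda>_. c) \<in> A"
    and add_mem: "f \<in> A \<Longrightarrow> g \<in> A \<Longrightarrow> f + g \<in> A"
    and mult_mem: "f \<in> A \<Longrightarrow> g \<in> A \<Longrightarrow> f * g \<in> A"
    and closed_mem: "(\<And>k. s k \<in> A) \<Longrightarrow> uniform_limit UNIV s f sequentially \<Longrightarrow> f \<in> A"
    and separates_points: "p \<noteq> q \<Longrightarrow> \<exists>f\<in>A. f p \<noteq> f q"

text \<open>
  The norm on \<open>M\<^sub>n(A)\<close> inherited from \<open>M\<^sub>n(C(\<Omega>)) = C(\<Omega>, M\<^sub>n)\<close>.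
\<close>

definition fun_mnorm :: "nat \<Rightarrow> (nat \<Rightarrow> nat \<Rightarrow> 't \<Rightarrow> complex) \<Rightarrow> real" where
  "fun_mnorm n a = (SUP p. op_norm n n (\<lambda>i j. a i j p))"

section \<open>Operator spaces and operator modules\<close>

definition direct_sum :: "nat \<Rightarrow> nat \<Rightarrow> (nat \<Rightarrow> nat \<Rightarrow> 'x::zero) \<Rightarrow> (nat \<Rightarrow> nat \<Rightarrow> 'x)
    \<Rightarrow> nat \<Rightarrow> nat \<Rightarrow> 'x" where
  "direct_sum m n x y = (\<lambda>i j.
     if i < m \<and> j < m then x i j
     else if m \<le> i \<and> i < m + n \<and> m \<le> j \<and> j < m + n then y (i - m) (j - m)
     else 0)"

text \<open>
  Complete abstract operator spaces: a complex vector space with a norm \<open>mnorm n\<close> on the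
  \<open>n\<close> by \<open>n\<close> matrices for every \<open>n\<close>, satisfying Ruan's two axioms.  The space is a whole type;
  its completeness and its real structure come from the class \<^class>\<open>banach\<close>, and the norm of
  that class is required to be the first matrix norm.  The axioms force \<open>mnorm 0 x = 0\<close>.
\<close>

locale operator_space = vector_space scaleC
  for scaleC :: "complex \<Rightarrow> 'x::banach \<Rightarrow> 'x" +
  fixes mnorm :: "nat \<Rightarrow> (nat \<Rightarrow> nat \<Rightarrow> 'x) \<Rightarrow> real"
  assumes scaleC_of_real: "scaleC (of_real r) x = r *\<^sub>R x"
    and mnorm_1: "mnorm 1 (\<lambda>_ _. x) = norm x"
    and mnorm_cong: "(\<And>i j. i < n \<Longrightarrow> j < n \<Longrightarrow> u i j = v i j) \<Longrightarrow> mnorm n u = mnorm n v"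
    and mnorm_eq_0_iff: "mnorm n u = 0 \<longleftrightarrow> (\<forall>i<n. \<forall>j<n. u i j = 0)"
    and mnorm_triangle: "mnorm n (\<lambda>i j. u i j + v i j) \<le> mnorm n u + mnorm n v"
    and mnorm_scale: "mnorm n (\<lambda>i j. scaleC c (u i j)) = cmod c * mnorm n u"
    and mnorm_direct_sum: "mnorm (m + n) (direct_sum m n u w) = max (mnorm m u) (mnorm n w)"
    and mnorm_compress:
      "mnorm n (\<lambda>i j. \<Sum>k<m. \<Sum>l<m. scaleC (a i k * b l j) (u k l))
         \<le> op_norm n m a * mnorm m u * op_norm m n b"

text \<open>
  Left operator modules.  The action is a function on all of \<open>'t \<Rightarrow> complex\<close>, but only its
  values on \<open>A\<close> are constrained or used.  The module inequality for rectangular matrices is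
  the one for square matrices after padding with zeros.
\<close>

locale operator_module = uniform_algebra A + operator_space scaleC mnorm
  for A :: "('t::t2_space \<Rightarrow> complex) set"
    and scaleC :: "complex \<Rightarrow> 'x::banach \<Rightarrow> 'x"
    and mnorm :: "nat \<Rightarrow> (nat \<Rightarrow> nat \<Rightarrow> 'x) \<Rightarrow> real" +
  fixes act :: "('t \<Rightarrow> complex) \<Rightarrow> 'x \<Rightarrow> 'x"
  assumes act_add_right: "a \<in> A \<Longrightarrow> act a (x + y) = act a x + act a y"
    and act_add_left: "a \<in> A \<Longrightarrow> b \<in> A \<Longrightarrow> act (a + b) x = act a x + act b x"
    and act_mult: "a \<in> A \<Longrightarrow> b \<in> A \<Longrightarrow> act (a * b) x = act a (act b x)"
    and act_const: "act (\<lambda>_. c) x = scaleC c x"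
    and act_one: "act 1 x = x"
    and act_mnorm_le: "(\<And>i j. i < n \<Longrightarrow> j < n \<Longrightarrow> \<alpha> i j \<in> A) \<Longrightarrow>
      mnorm n (\<lambda>i j. \<Sum>k<n. act (\<alpha> i k) (u k j)) \<le> fun_mnorm n \<alpha> * mnorm n u"

definition singly_generated ::
    "('t \<Rightarrow> complex) set \<Rightarrow> (('t \<Rightarrow> complex) \<Rightarrow> 'x::topological_space \<Rightarrow> 'x) \<Rightarrow> bool" where
  "singly_generated A act \<longleftrightarrow> (\<exists>x. closure ((\<lambda>a. act a x) ` A) = UNIV)"

section \<open>The row modules\<close>

text \<open>Tuples of length \<open>n\<close> are functions vanishing from \<open>n\<close> on.\<close>

definition row_space :: "('t \<Rightarrow> complex) set \<Rightarrow> nat \<Rightarrow> (nat \<Rightarrow> 't \<Rightarrow> complex) set" where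
  "row_space A n = {v. (\<forall>l<n. v l \<in> A) \<and> (\<forall>l\<ge>n. v l = 0)}"

definition row_act :: "('t \<Rightarrow> complex) \<Rightarrow> (nat \<Rightarrow> 't \<Rightarrow> complex) \<Rightarrow> nat \<Rightarrow> 't \<Rightarrow> complex" where
  "row_act a v = (\<lambda>l. a * v l)"

text \<open>
  A \<open>k\<close> by \<open>k\<close> matrix \<open>u\<close> of rows becomes an element of \<open>M\<^sub>k(M\<^sub>n(A)) = M\<^sub>k\<^sub>n(A)\<close>: its block \<open>(i, j)\<close>
  has first row \<open>u i j\<close> and zeros elsewhere.
\<close>

definition row_mnorm :: "nat \<Rightarrow> nat \<Rightarrow> (nat \<Rightarrow> nat \<Rightarrow> nat \<Rightarrow> 't \<Rightarrow> complex) \<Rightarrow> real" where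
  "row_mnorm n k u =
     fun_mnorm (k * n) (\<lambda>r c. if r mod n = 0 then u (r div n) (c div n) (c mod n) else 0)"

section \<open>Completely contractive module maps and the completely bounded norm\<close>

text \<open>Complex linearity is module linearity over the constants in \<open>A\<close>.\<close>

definition cc_module_map ::
    "'s set \<Rightarrow> 'x set \<Rightarrow> ('s \<Rightarrow> 'x \<Rightarrow> 'x) \<Rightarrow> (nat \<Rightarrow> (nat \<Rightarrow> nat \<Rightarrow> 'x) \<Rightarrow> real) \<Rightarrow>
     'y set \<Rightarrow> ('s \<Rightarrow> 'y \<Rightarrow> 'y) \<Rightarrow> (nat \<Rightarrow> (nat \<Rightarrow> nat \<Rightarrow> 'y) \<Rightarrow> real) \<Rightarrow>
     ('x::plus \<Rightarrow> 'y::plus) \<Rightarrow> bool" where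
  "cc_module_map A X actX normX Y actY normY T \<longleftrightarrow>
     (\<forall>x\<in>X. T x \<in> Y) \<and>
     (\<forall>x\<in>X. \<forall>y\<in>X. T (x + y) = T x + T y) \<and>
     (\<forall>a\<in>A. \<forall>x\<in>X. T (actX a x) = actY a (T x)) \<and>
     (\<forall>k u. (\<forall>i<k. \<forall>j<k. u i j \<in> X) \<longrightarrow> normY k (\<lambda>i j. T (u i j)) \<le> normX k u)"

definition cb_norm ::
    "'x set \<Rightarrow> (nat \<Rightarrow> (nat \<Rightarrow> nat \<Rightarrow> 'x) \<Rightarrow> real) \<Rightarrow> (nat \<Rightarrow> (nat \<Rightarrow> nat \<Rightarrow> 'y) \<Rightarrow> real) \<Rightarrow>
     ('x \<Rightarrow> 'y) \<Rightarrow> ennreal" where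
  "cb_norm X normX normY T =
     (SUP k. SUP u \<in> {u. (\<forall>i<k. \<forall>j<k. u i j \<in> X) \<and> normX k u \<le> 1}.
        ennreal (normY k (\<lambda>i j. T (u i j))))"

section \<open>Nets\<close>

definition directed :: "'i set \<Rightarrow> ('i \<Rightarrow> 'i \<Rightarrow> bool) \<Rightarrow> bool" where
  "directed I le \<longleftrightarrow> I \<noteq> {} \<and> (\<forall>i\<in>I. le i i) \<and>
     (\<forall>i\<in>I. \<forall>j\<in>I. \<forall>k\<in>I. le i j \<longrightarrow> le j k \<longrightarrow> le i k) \<and>
     (\<forall>i\<in>I. \<forall>j\<in>I. \<exists>k\<in>I. le i k \<and> le j k)"

definition along :: "'i set \<Rightarrow> ('i \<Rightarrow> 'i \<Rightarrow> bool) \<Rightarrow> 'i filter" where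
  "along I le = (INF i\<in>I. principal {j\<in>I. le i j})"

lemma eventually_along:
  assumes "directed I le"
  shows "eventually P (along I le) \<longleftrightarrow> (\<exists>i\<in>I. \<forall>j\<in>I. le i j \<longrightarrow> P j)"
proof -
  have "eventually P (along I le) \<longleftrightarrow> (\<exists>i\<in>I. eventually P (principal {j\<in>I. le i j}))"
    unfolding along_def
  proof (rule eventually_INF_base)
    show "I \<noteq> {}" using assms by (simp add: directed_def)
    fix a b assume "a \<in> I" "b \<in> I"
    with assms obtain c where c: "c \<in> I" "le a c" "le b c" unfolding directed_def by meson
    have "{j\<in>I. le c j} \<subseteq> {j\<in>I. le a j} \<inter> {j\<in>I. le b j}"
      using assms \<open>a \<in> I\<close> \<open>b \<in> I\<close> c unfolding directed_def by blast
    with c show "\<exists>x\<in>I. principal {j\<in>I. le x j} \<le> inf (principal {j\<in>I. le a j}) (principal {j\<in>I. le b j})"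
      by auto
  qed
  then show ?thesis by (auto simp: eventually_principal)
qed

section \<open>Hilbertian and rigged modules\<close>

text \<open>
  A net consists of triples \<open>(n\<^sub>\<alpha>, \<phi>\<^sub>\<alpha>, \<psi>\<^sub>\<alpha>)\<close>.  The type \<open>'i\<close> of its indices is a parameter of
  the two predicates below and is then fixed to a type which is large enough to realise every
  net, see the lemmas \<open>hilbertian_of_any_index\<close> and \<open>rigged_of_any_index\<close>.
\<close>

type_synonym ('t, 'x) factorization =
  "nat \<times> ('x \<Rightarrow> nat \<Rightarrow> 't \<Rightarrow> complex) \<times> ((nat \<Rightarrow> 't \<Rightarrow> complex) \<Rightarrow> 'x)"

definition row_dim :: "('t, 'x) factorization \<Rightarrow> nat" where
  "row_dim t = fst t"

definition to_row :: "('t, 'x) factorization \<Rightarrow> 'x \<Rightarrow> nat \<Rightarrow> 't \<Rightarrow> complex" where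
  "to_row t = fst (snd t)"

definition from_row :: "('t, 'x) factorization \<Rightarrow> (nat \<Rightarrow> 't \<Rightarrow> complex) \<Rightarrow> 'x" where
  "from_row t = snd (snd t)"

definition cc_factorization ::
    "('t \<Rightarrow> complex) set \<Rightarrow> (nat \<Rightarrow> (nat \<Rightarrow> nat \<Rightarrow> 'x) \<Rightarrow> real) \<Rightarrow>
     (('t \<Rightarrow> complex) \<Rightarrow> 'x \<Rightarrow> 'x) \<Rightarrow> ('t, 'x::plus) factorization \<Rightarrow> bool" where
  "cc_factorization A mnorm act t \<longleftrightarrow>
     row_dim t > 0 \<and>
     cc_module_map A UNIV act mnorm
       (row_space A (row_dim t)) row_act (row_mnorm (row_dim t)) (to_row t) \<and>
     cc_module_map A (row_space A (row_dim t)) row_act (row_mnorm (row_dim t))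
       UNIV act mnorm (from_row t)"

definition hilbertian_net ::
    "('t \<Rightarrow> complex) set \<Rightarrow> (nat \<Rightarrow> (nat \<Rightarrow> nat \<Rightarrow> 'x) \<Rightarrow> real) \<Rightarrow>
     (('t \<Rightarrow> complex) \<Rightarrow> 'x \<Rightarrow> 'x) \<Rightarrow>
     'i set \<Rightarrow> ('i \<Rightarrow> 'i \<Rightarrow> bool) \<Rightarrow> ('i \<Rightarrow> ('t, 'x::banach) factorization) \<Rightarrow> bool" where
  "hilbertian_net A mnorm act I le t \<longleftrightarrow>
     directed I le \<and>
     (\<forall>\<alpha>\<in>I. cc_factorization A mnorm act (t \<alpha>)) \<and>
     (\<forall>x. ((\<lambda>\<alpha>. from_row (t \<alpha>) (to_row (t \<alpha>) x)) \<longlongrightarrow> x) (along I le))"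

definition rigged_net ::
    "('t \<Rightarrow> complex) set \<Rightarrow> (nat \<Rightarrow> (nat \<Rightarrow> nat \<Rightarrow> 'x) \<Rightarrow> real) \<Rightarrow>
     (('t \<Rightarrow> complex) \<Rightarrow> 'x \<Rightarrow> 'x) \<Rightarrow>
     'i set \<Rightarrow> ('i \<Rightarrow> 'i \<Rightarrow> bool) \<Rightarrow> ('i \<Rightarrow> ('t, 'x::banach) factorization) \<Rightarrow> bool" where
  "rigged_net A mnorm act I le t \<longleftrightarrow>
     hilbertian_net A mnorm act I le t \<and>
     (\<forall>\<beta>\<in>I. ((\<lambda>\<alpha>. cb_norm UNIV mnorm (row_mnorm (row_dim (t \<beta>)))
          (\<lambda>x. to_row (t \<beta>) (from_row (t \<alpha>) (to_row (t \<alpha>) x)) - to_row (t \<beta>) x))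
        \<longlongrightarrow> 0) (along I le))"

type_synonym ('t, 'x) net_index = "('t, 'x) factorization set \<times> ('t, 'x) factorization"

definition hilbertian ::
    "('t \<Rightarrow> complex) set \<Rightarrow> (nat \<Rightarrow> (nat \<Rightarrow> nat \<Rightarrow> 'x::banach) \<Rightarrow> real) \<Rightarrow>
     (('t \<Rightarrow> complex) \<Rightarrow> 'x \<Rightarrow> 'x) \<Rightarrow> bool" where
  "hilbertian A mnorm act \<longleftrightarrow>
     (\<exists>(I :: ('t, 'x) net_index set) le t. hilbertian_net A mnorm act I le t)"

definition rigged ::
    "('t \<Rightarrow> complex) set \<Rightarrow> (nat \<Rightarrow> (nat \<Rightarrow> nat \<Rightarrow> 'x::banach) \<Rightarrow> real) \<Rightarrow>
     (('t \<Rightarrow> complex) \<Rightarrow> 'x \<Rightarrow> 'x) \<Rightarrow> bool" where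
  "rigged A mnorm act \<longleftrightarrow>
     (\<exists>(I :: ('t, 'x) net_index set) le t. rigged_net A mnorm act I le t)"

text \<open>
  Any net can be reindexed, without changing the set of its members or its filter of tails, by
  the pairs of a set of members forming a tail and an element of that set.
\<close>

lemma reindex_net:
  fixes t :: "'i \<Rightarrow> 'b"
  assumes dir: "directed I le"
  obtains J :: "('b set \<times> 'b) set" and le'
  where "directed J le'" "snd ` J \<subseteq> t ` I"
    "filtermap snd (along J le') = filtermap t (along I le)"
proof -
  define tl where "tl i = t ` {j\<in>I. le i j}" for i
  define J where "J = {(E, p). p \<in> E \<and> (\<exists>i\<in>I. E = tl i)}"
  define le' :: "'b set \<times> 'b \<Rightarrow> 'b set \<times> 'b \<Rightarrow> bool"
    where "le' = (\<lambda>q r. fst r \<subseteq> fst q)"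
  have refl: "le i i" if "i \<in> I" for i using dir that by (simp add: directed_def)
  have tl_mem: "(tl i, t i) \<in> J" if "i \<in> I" for i
    using that refl[OF that] unfolding J_def tl_def by auto
  have tl_sub: "tl k \<subseteq> tl i" if "i \<in> I" "k \<in> I" "le i k" for i k
    using dir that unfolding tl_def directed_def by blast
  have dirJ: "directed J le'"
    unfolding directed_def
  proof (intro conjI ballI)
    show "J \<noteq> {}" using tl_mem dir unfolding directed_def by blast
    fix q r assume "q \<in> J" "r \<in> J"
    then obtain i j where ij: "i \<in> I" "j \<in> I" "fst q = tl i" "fst r = tl j"
      unfolding J_def by auto
    obtain k where k: "k \<in> I" "le i k" "le j k" using dir ij unfolding directed_def by meson
    show "\<exists>s\<in>J. le' q s \<and> le' r s"
      by (rule bexI[OF _ tl_mem[OF k(1)]]) (use tl_sub ij k in \<open>auto simp: le'_def\<close>)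
  qed (auto simp: le'_def)
  have "eventually P (filtermap snd (along J le')) \<longleftrightarrow> eventually P (filtermap t (along I le))"
    for P
  proof -
    have "(\<exists>q\<in>J. \<forall>r\<in>J. le' q r \<longrightarrow> P (snd r)) \<longleftrightarrow> (\<exists>i\<in>I. \<forall>j\<in>I. le i j \<longrightarrow> P (t j))"
      (is "?L \<longleftrightarrow> ?R")
    proof
      assume ?L
      then obtain q where q: "q \<in> J" "\<And>r. r \<in> J \<Longrightarrow> le' q r \<Longrightarrow> P (snd r)" by blast
      then obtain i where i: "i \<in> I" "fst q = tl i" unfolding J_def by auto
      have "P (t j)" if "j \<in> I" "le i j" for j
        using q(2)[OF tl_mem[OF that(1)]] tl_sub[OF i(1) that] i(2) by (simp add: le'_def)
      with i show ?R by blast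
    next
      assume ?R
      then obtain i where i: "i \<in> I" "\<And>j. j \<in> I \<Longrightarrow> le i j \<Longrightarrow> P (t j)" by blast
      have "P (snd r)" if "r \<in> J" "le' (tl i, t i) r" for r
      proof -
        have "snd r \<in> tl i" using that unfolding J_def le'_def by auto
        then show ?thesis using i(2) unfolding tl_def by auto
      qed
      with tl_mem[OF i(1)] show ?L by blast
    qed
    then show ?thesis by (simp add: eventually_filtermap eventually_along dir dirJ)
  qed
  then have "filtermap snd (along J le') = filtermap t (along I le)"
    by (simp add: filter_eq_iff)
  moreover have "snd ` J \<subseteq> t ` I" unfolding J_def tl_def by auto
  ultimately show ?thesis using dirJ that by blast
qed

lemma filterlim_reindex:
  assumes "filtermap s F = filtermap t G"
  shows "filterlim (\<lambda>\<alpha>. g (s \<alpha>)) H F \<longleftrightarrow> filterlim (\<lambda>\<alpha>. g (t \<alpha>)) H G"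
proof -
  have "filterlim g H (filtermap s F) \<longleftrightarrow> filterlim g H (filtermap t G)"
    by (rule arg_cong[OF assms])
  then show ?thesis unfolding filterlim_filtermap .
qed

lemma hilbertian_net_reindex:
  fixes t :: "'i \<Rightarrow> ('t, 'x::banach) factorization"
  assumes "hilbertian_net A mnorm act I le t"
    and "directed J le'" "snd ` J \<subseteq> t ` I"
    and eq: "filtermap snd (along J le') = filtermap t (along I le)"
  shows "hilbertian_net A mnorm act J le' snd"
  unfolding hilbertian_net_def
proof (intro conjI ballI allI)
  show "cc_factorization A mnorm act (snd \<alpha>)" if "\<alpha> \<in> J" for \<alpha>
  proof -
    have "\<forall>i\<in>I. cc_factorization A mnorm act (t i)"
      using assms(1) unfolding hilbertian_net_def by (elim conjE)
    moreover have "snd \<alpha> \<in> t ` I" using assms(3) imageI[OF that] by (rule subsetD)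
    ultimately show ?thesis by (elim imageE) simp
  qed
  show "((\<lambda>\<alpha>. from_row (snd \<alpha>) (to_row (snd \<alpha>) x)) \<longlongrightarrow> x) (along J le')" for x
  proof -
    define g where "g s = from_row s (to_row s x)" for s :: "('t, 'x) factorization"
    have "((\<lambda>\<alpha>. g (t \<alpha>)) \<longlongrightarrow> x) (along I le)"
      using assms(1) unfolding hilbertian_net_def g_def by blast
    then have "((\<lambda>\<alpha>. g (snd \<alpha>)) \<longlongrightarrow> x) (along J le')"
      by (rule iffD2[OF filterlim_reindex[OF eq]])
    then show ?thesis unfolding g_def .
  qed
qed (fact assms(2))

lemma hilbertian_of_any_index:
  fixes I :: "'i set" and act :: "('t \<Rightarrow> complex) \<Rightarrow> 'x::banach \<Rightarrow> 'x"
  assumes "hilbertian_net A mnorm act I le t"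
  shows "hilbertian A mnorm act"
proof -
  from assms have dir: "directed I le" by (simp add: hilbertian_net_def)
  obtain J :: "('t, 'x) net_index set" and le' where J: "directed J le'" "snd ` J \<subseteq> t ` I"
    "filtermap snd (along J le') = filtermap t (along I le)"
    by (rule reindex_net[OF dir, where t = t])
  have "hilbertian_net A mnorm act J le' snd"
    using assms J by (rule hilbertian_net_reindex)
  then show ?thesis unfolding hilbertian_def by blast
qed

lemma rigged_of_any_index:
  fixes I :: "'i set" and act :: "('t \<Rightarrow> complex) \<Rightarrow> 'x::banach \<Rightarrow> 'x"
  assumes "rigged_net A mnorm act I le t"
  shows "rigged A mnorm act"
proof -
  have H: "hilbertian_net A mnorm act I le t"
    using assms unfolding rigged_net_def by (rule conjunct1)
  then have dir: "directed I le" by (simp add: hilbertian_net_def)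
  obtain J :: "('t, 'x) net_index set" and le' where J: "directed J le'" "snd ` J \<subseteq> t ` I"
    "filtermap snd (along J le') = filtermap t (along I le)"
    by (rule reindex_net[OF dir, where t = t])
  have 1: "hilbertian_net A mnorm act J le' snd"
    using H J by (rule hilbertian_net_reindex)
  have 2: "((\<lambda>\<alpha>. cb_norm UNIV mnorm (row_mnorm (row_dim (snd \<beta>)))
          (\<lambda>x. to_row (snd \<beta>) (from_row (snd \<alpha>) (to_row (snd \<alpha>) x)) - to_row (snd \<beta>) x))
        \<longlongrightarrow> 0) (along J le')" if "\<beta> \<in> J" for \<beta>
  proof -
    have "snd \<beta> \<in> t ` I" using J(2) imageI[OF that] by (rule subsetD)
    then obtain b where b: "snd \<beta> = t b" "b \<in> I" by (rule imageE)
    define g where "g s = cb_norm UNIV mnorm (row_mnorm (row_dim (t b)))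
          (\<lambda>x. to_row (t b) (from_row s (to_row s x)) - to_row (t b) x)" for s :: "('t, 'x) factorization"
    have "((\<lambda>\<alpha>. g (t \<alpha>)) \<longlongrightarrow> 0) (along I le)"
      using assms b(2) unfolding rigged_net_def g_def by blast
    then have "((\<lambda>\<alpha>. g (snd \<alpha>)) \<longlongrightarrow> 0) (along J le')"
      by (rule iffD2[OF filterlim_reindex[OF J(3)]])
    then show ?thesis unfolding g_def b(1) .
  qed
  have "rigged_net A mnorm act J le' snd"
    unfolding rigged_net_def by (intro conjI ballI 1 2)
  then show ?thesis unfolding rigged_def by blast
qed

end

theory Submission
  imports Defs
begin

text \<open>
  Put \<open>T\<^sub>\<alpha> = \<psi>\<^sub>\<alpha> \<circ> \<phi>\<^sub>\<alpha>\<close>.  The net with \<open>\<phi>\<^sub>\<alpha>\<close> replaced by \<open>\<phi>\<^sub>\<alpha> \<circ> T\<^sub>\<alpha>\<close> is rigged.  Since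
  \<open>T\<^sub>\<beta> z = \<Sum>\<^sub>l \<phi>\<^sub>\<beta>(z)\<^sub>l x\<^sub>l\<close> with \<open>x\<^sub>l = \<psi>\<^sub>\<beta>(e\<^sub>l)\<close>, the map \<open>(T\<^sub>\<alpha>\<^sup>2 - 1) \<circ> T\<^sub>\<beta>\<close> has completely bounded norm
  at most \<open>\<Sum>\<^sub>l \<parallel>T\<^sub>\<alpha>\<^sup>2 x\<^sub>l - x\<^sub>l\<parallel>\<close>, which tends to 0; so it suffices that \<open>T\<^sub>\<alpha>\<close> and \<open>T\<^sub>\<beta>\<close> commute.
  This is where a single generator \<open>x\<close> enters: for a bounded module map \<open>\<omega> : X \<rightarrow> A\<close> and a
  bounded module endomorphism \<open>T\<close> one has \<open>\<omega>(y) \<omega>(T z) = \<omega>(z) \<omega>(T y)\<close>, by density of \<open>A x\<close>.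
  Hence \<open>\<omega>(x) \<omega>(S T x) = \<omega>(S x) \<omega>(T x) = \<omega>(x) \<omega>(T S x)\<close>, while every \<open>\<omega>(y)\<close> vanishes at
  the zeros of \<open>\<omega>(x)\<close>; and the coordinates of the \<open>\<phi>\<^sub>\<alpha>\<close> separate the points of \<open>X\<close>.
\<close>

section \<open>Nets\<close>

text \<open>The filter \<open>along I le\<close> lives on the whole index type, whereas the data of
  a net is constrained only on \<open>I\<close>; eventual statements about the net pass through this
  fact.\<close>

lemma eventually_along_mem:
  assumes "directed I le"
  shows "eventually (\<lambda>\<alpha>. \<alpha> \<in> I) (along I le)"
proof -
  obtain i where "i \<in> I" using assms unfolding directed_def by blast
  then show ?thesis by (intro iffD2[OF eventually_along[OF assms]] bexI ballI impI)
qed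

lemma along_neq_bot:
  assumes "directed I le"
  shows "along I le \<noteq> bot"
proof
  assume "along I le = bot"
  then have "eventually (\<lambda>_. False) (along I le)" by simp
  then obtain i where i: "i \<in> I" "\<And>j. j \<in> I \<Longrightarrow> \<not> le i j"
    using iffD1[OF eventually_along[OF assms]] by blast
  then show False using assms unfolding directed_def by blast
qed

section \<open>Matrix norms\<close>

text \<open>Coordinates of a vector in the unit ball have modulus at most 1. The bound is crude; it
  serves to show that the suprema in \<open>op_norm\<close> and \<open>fun_mnorm\<close> are taken
  over bounded sets.\<close>

lemma op_norm_vector_le:
  fixes m n :: nat
  assumes "L2_set (\<lambda>j. cmod (v j)) {..<n} \<le> 1"
  shows "L2_set (\<lambda>i. cmod (\<Sum>j<n. a i j * v j)) {..<m} \<le> (\<Sum>i<m. \<Sum>j<n. cmod (a i j))"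
proof -
  have v: "cmod (v j) \<le> 1" if "j < n" for j
    by (rule order_trans[OF member_le_L2_set assms]) (use that in auto)
  have "L2_set (\<lambda>i. cmod (\<Sum>j<n. a i j * v j)) {..<m} \<le> (\<Sum>i<m. cmod (\<Sum>j<n. a i j * v j))"
    by (rule L2_set_le_sum) simp
  also have "\<dots> \<le> (\<Sum>i<m. \<Sum>j<n. cmod (a i j))"
  proof (intro sum_mono order_trans[OF norm_sum])
    fix i j assume "j \<in> {..<n}"
    then show "cmod (a i j * v j) \<le> cmod (a i j)"
      using v[of j] by (simp add: norm_mult mult_left_le)
  qed
  finally show ?thesis .
qed

lemma op_norm_upper:
  assumes "L2_set (\<lambda>j. cmod (v j)) {..<n} \<le> 1"
  shows "L2_set (\<lambda>i. cmod (\<Sum>j<n. a i j * v j)) {..<m} \<le> op_norm m n a"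
  unfolding op_norm_def
proof (rule cSup_upper)
  show "bdd_above {L2_set (\<lambda>i. cmod (\<Sum>j<n. a i j * v j)) {..<m} | v.
            L2_set (\<lambda>j. cmod (v j)) {..<n} \<le> 1}"
    by (rule bdd_aboveI[of _ "\<Sum>i<m. \<Sum>j<n. cmod (a i j)"]) (auto intro: op_norm_vector_le)
  show "L2_set (\<lambda>i. cmod (\<Sum>j<n. a i j * v j)) {..<m}
      \<in> {L2_set (\<lambda>i. cmod (\<Sum>j<n. a i j * v j)) {..<m} | v. L2_set (\<lambda>j. cmod (v j)) {..<n} \<le> 1}"
    by (rule CollectI, rule exI[of _ v], intro conjI refl assms)
qed

lemma op_norm_least:
  assumes "\<And>v. L2_set (\<lambda>j. cmod (v j)) {..<n} \<le> 1 \<Longrightarrow>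
    L2_set (\<lambda>i. cmod (\<Sum>j<n. a i j * v j)) {..<m} \<le> C"
  shows "op_norm m n a \<le> C"
  unfolding op_norm_def
proof (rule cSup_least)
  have "L2_set (\<lambda>j. cmod 0) {..<n} \<le> 1" by (simp add: L2_set_def)
  then show "{L2_set (\<lambda>i. cmod (\<Sum>j<n. a i j * v j)) {..<m} | v.
            L2_set (\<lambda>j. cmod (v j)) {..<n} \<le> 1} \<noteq> {}" by (auto intro: exI[of _ "\<lambda>_. 0"])
  fix r assume "r \<in> {L2_set (\<lambda>i. cmod (\<Sum>j<n. a i j * v j)) {..<m} | v.
            L2_set (\<lambda>j. cmod (v j)) {..<n} \<le> 1}"
  then show "r \<le> C" using assms by (elim CollectE exE conjE) (simp only:)
qed

text \<open>Extending a vector by zero along \<open>g\<close> does not change its norm, and dropping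
  the rows outside the image of \<open>f\<close> can only shrink the product.\<close>

lemma op_norm_submatrix_le:
  assumes f: "inj_on f {..<m'}" "f ` {..<m'} \<subseteq> {..<m}"
    and g: "inj_on g {..<n'}" "g ` {..<n'} \<subseteq> {..<n}"
  shows "op_norm m' n' (\<lambda>i j. a (f i) (g j)) \<le> op_norm m n a"
proof (rule op_norm_least)
  fix v assume v: "L2_set (\<lambda>j. cmod (v j)) {..<n'} \<le> 1"
  define V where "V c = (if c \<in> g ` {..<n'} then v (inv_into {..<n'} g c) else 0)" for c
  have Vg: "V (g j) = v j" if "j < n'" for j
    using g(1) that by (simp add: V_def)
  \<comment> \<open>Left general in \<open>h\<close>, to serve both for the squared norm of
    \<open>V\<close> and for the products of matrix rows with \<open>V\<close>.\<close>
  have extend: "(\<Sum>c<n. h c (V c)) = (\<Sum>j<n'. h (g j) (v j))"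
    if "\<And>c. h c 0 = 0" for h :: "nat \<Rightarrow> complex \<Rightarrow> 'b::comm_monoid_add"
  proof -
    have "(\<Sum>c<n. h c (V c)) = (\<Sum>c\<in>g ` {..<n'}. h c (V c))"
      by (rule sum.mono_neutral_right) (use g(2) that in \<open>auto simp: V_def\<close>)
    also have "\<dots> = (\<Sum>j<n'. h (g j) (v j))"
      using Vg by (simp add: sum.reindex[OF g(1)])
    finally show ?thesis .
  qed
  have "L2_set (\<lambda>c. cmod (V c)) {..<n} \<le> 1"
    using v extend[of "\<lambda>_ z. (cmod z)\<^sup>2"] by (simp add: L2_set_def)
  note upper = op_norm_upper[OF this, of a m]
  have "(\<Sum>i<m'. (cmod (\<Sum>j<n'. a (f i) (g j) * v j))\<^sup>2)
      = (\<Sum>i<m'. (cmod (\<Sum>c<n. a (f i) c * V c))\<^sup>2)"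
    using extend[of "\<lambda>c z. a (f _) c * z"] by simp
  also have "\<dots> = (\<Sum>r\<in>f ` {..<m'}. (cmod (\<Sum>c<n. a r c * V c))\<^sup>2)"
    by (simp add: sum.reindex[OF f(1)])
  also have "\<dots> \<le> (\<Sum>r<m. (cmod (\<Sum>c<n. a r c * V c))\<^sup>2)"
    by (rule sum_mono2) (use f(2) in auto)
  finally show "L2_set (\<lambda>i. cmod (\<Sum>j<n'. a (f i) (g j) * v j)) {..<m'} \<le> op_norm m n a"
    using upper unfolding L2_set_def by (meson order_trans real_sqrt_le_mono)
qed

lemma norm_entry_le_op_norm: "cmod (a 0 0) \<le> op_norm 1 1 a"
proof -
  have "L2_set (\<lambda>j. cmod 1) {..<1::nat} \<le> 1" by (simp add: L2_set_def)
  from op_norm_upper[OF this, of a 1] show ?thesis by (simp add: L2_set_def)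
qed

section \<open>Matrices over a uniform algebra and over its row modules\<close>

context uniform_algebra
begin

lemma zero_mem: "0 \<in> A"
  using const_mem[of 0] by (simp add: zero_fun_def)

lemma one_mem: "1 \<in> A"
  using const_mem[of 1] by (simp add: one_fun_def)

text \<open>Compactness enters here: elements of \<open>A\<close> are bounded functions, which makes
  the supremum in \<open>fun_mnorm\<close> a genuine one.\<close>

lemma bdd_above_op_norm:
  assumes "\<And>i j. i < n \<Longrightarrow> j < n \<Longrightarrow> a i j \<in> A"
  shows "bdd_above (range (\<lambda>p. op_norm n n (\<lambda>i j. a i j p)))"
proof -
  have "\<exists>B. \<forall>p. cmod (f p) \<le> B" if "f \<in> A" for f
  proof -
    have "bounded (range f)"
      by (intro compact_imp_bounded compact_continuous_image continuous that compact_domain)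
    then show ?thesis by (simp add: bounded_iff)
  qed
  then have "\<forall>f\<in>A. \<exists>B. \<forall>p. cmod (f p) \<le> B" by blast
  from bchoice[OF this] obtain B where B: "\<And>f p. f \<in> A \<Longrightarrow> cmod (f p) \<le> B f" by blast
  have "op_norm n n (\<lambda>i j. a i j p) \<le> (\<Sum>i<n. \<Sum>j<n. B (a i j))" for p
  proof (rule op_norm_least)
    fix v assume "L2_set (\<lambda>j. cmod (v j)) {..<n} \<le> 1"
    from op_norm_vector_le[OF this, of "\<lambda>i j. a i j p" n]
    have "L2_set (\<lambda>i. cmod (\<Sum>j<n. a i j p * v j)) {..<n} \<le> (\<Sum>i<n. \<Sum>j<n. cmod (a i j p))" .
    also have "\<dots> \<le> (\<Sum>i<n. \<Sum>j<n. B (a i j))"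
      by (intro sum_mono B assms) auto
    finally show "L2_set (\<lambda>i. cmod (\<Sum>j<n. a i j p * v j)) {..<n} \<le> (\<Sum>i<n. \<Sum>j<n. B (a i j))" .
  qed
  then show ?thesis by (intro bdd_aboveI[of _ "\<Sum>i<n. \<Sum>j<n. B (a i j)"]) auto
qed

text \<open>The matrix of \<open>l\<close>-th coordinates sits inside the big matrix of
  \<open>row_mnorm\<close>, in the rows \<open>i * n\<close> and the columns
  \<open>j * n + l\<close>.\<close>

lemma fun_mnorm_coordinate_le_row_mnorm:
  assumes l: "l < n" and u: "\<And>i j. i < k \<Longrightarrow> j < k \<Longrightarrow> u i j \<in> row_space A n"
  shows "fun_mnorm k (\<lambda>i j. u i j l) \<le> row_mnorm n k u"
  unfolding row_mnorm_def fun_mnorm_def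
proof (rule cSUP_mono)
  define b where "b r c = (if r mod n = 0 then u (r div n) (c div n) (c mod n) else 0)" for r c
  have n: "n > 0" using l by simp
  have "b r c \<in> A" if "r < k * n" "c < k * n" for r c
  proof -
    have "r div n < k" "c div n < k" "c mod n < n"
      using that n by (auto simp: less_mult_imp_div_less)
    then show ?thesis using u zero_mem unfolding b_def row_space_def by auto
  qed
  from bdd_above_op_norm[OF this]
  show "bdd_above (range (\<lambda>p. op_norm (k * n) (k * n)
      (\<lambda>i j. (if i mod n = 0 then u (i div n) (j div n) (j mod n) else 0) p)))"
    by (simp add: b_def)
  have idx: "j * n + d < k * n" if "j < k" "d < n" for j d
  proof -
    have "j * n + d < Suc j * n" using that by simp
    also have "\<dots> \<le> k * n" using that by (intro mult_le_mono1) simp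
    finally show ?thesis .
  qed
  have "op_norm k k (\<lambda>i j. u i j l p) \<le> op_norm (k * n) (k * n) (\<lambda>r c. b r c p)" for p
  proof -
    have "op_norm k k (\<lambda>i j. b (i * n) (j * n + l) p) \<le> op_norm (k * n) (k * n) (\<lambda>r c. b r c p)"
      by (rule op_norm_submatrix_le[where f = "\<lambda>i. i * n" and g = "\<lambda>j. j * n + l"])
        (use n l idx in \<open>auto simp: inj_on_def\<close>)
    then show ?thesis using n l by (simp add: b_def)
  qed
  then show "\<exists>q\<in>UNIV. op_norm k k (\<lambda>i j. u i j l p) \<le> op_norm (k * n) (k * n)
      (\<lambda>i j. (if i mod n = 0 then u (i div n) (j div n) (j mod n) else 0) q)" for p
    by (auto simp: b_def)
qed simp

end

section \<open>Consequences of Ruan's axioms\<close>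

context operator_space
begin

lemma mnorm_zero: "mnorm n (\<lambda>_ _. 0) = 0"
  by (rule iffD2[OF mnorm_eq_0_iff]) blast

lemma mnorm_sum_le: "mnorm n (\<lambda>i j. \<Sum>l\<in>L. u l i j) \<le> (\<Sum>l\<in>L. mnorm n (u l))"
proof (induction L rule: infinite_finite_induct)
  case (insert l L)
  have "mnorm n (\<lambda>i j. u l i j + (\<Sum>l\<in>L. u l i j)) \<le> mnorm n (u l) + mnorm n (\<lambda>i j. \<Sum>l\<in>L. u l i j)"
    by (rule mnorm_triangle)
  also have "\<dots> \<le> mnorm n (u l) + (\<Sum>l\<in>L. mnorm n (u l))"
    by (rule add_left_mono) (rule insert.IH)
  finally show ?case by (simp only: sum.insert[OF insert.hyps])
next
  case (infinite L)
  then show ?case by (simp add: mnorm_zero)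
next
  case empty
  then show ?case by (simp add: mnorm_zero)
qed

text \<open>The last diagonal entry splits off as a 1 by 1 direct summand. At \<open>k = 0\<close>
  the left side is 0, hence an inequality.\<close>

lemma mnorm_diagonal_le: "mnorm k (\<lambda>i j. if i = j then y else 0) \<le> norm y"
proof (induction k)
  case 0
  have "mnorm 0 (\<lambda>i j. if i = j then y else 0) = 0"
    by (rule iffD2[OF mnorm_eq_0_iff]) blast
  then show ?case by simp
next
  case (Suc k)
  have "mnorm (k + 1) (\<lambda>i j. if i = j then y else 0)
      = mnorm (k + 1) (direct_sum k 1 (\<lambda>i j. if i = j then y else 0) (\<lambda>_ _. y))"
    by (rule mnorm_cong) (auto simp: direct_sum_def)
  also have "\<dots> = max (mnorm k (\<lambda>i j. if i = j then y else 0)) (norm y)"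
    by (simp only: mnorm_direct_sum mnorm_1)
  also have "\<dots> \<le> norm y" using Suc.IH by (intro max.boundedI order_refl)
  finally show ?case by (simp only: Suc_eq_plus1)
qed

end

section \<open>Completely contractive module maps\<close>

lemma
  assumes "cc_module_map A X actX normX Y actY normY T"
  shows cc_module_map_mem: "x \<in> X \<Longrightarrow> T x \<in> Y"
    and cc_module_map_norm_le:
      "(\<And>i j. i < k \<Longrightarrow> j < k \<Longrightarrow> u i j \<in> X) \<Longrightarrow> normY k (\<lambda>i j. T (u i j)) \<le> normX k u"
  using assms unfolding cc_module_map_def by simp_all

context operator_module
begin

abbreviation "endo \<equiv> cc_module_map A UNIV act mnorm UNIV act mnorm"

abbreviation "row_map n \<equiv> cc_module_map A UNIV act mnorm (row_space A n) row_act (row_mnorm n)"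

abbreviation "row_comap n \<equiv> cc_module_map A (row_space A n) row_act (row_mnorm n) UNIV act mnorm"

text \<open>With \<open>y\<close> along a diagonal, the entries \<open>act (\<alpha> i j) y\<close>
  form a matrix product, to which the module inequality applies.\<close>

lemma mnorm_act_le:
  assumes "\<And>i j. i < k \<Longrightarrow> j < k \<Longrightarrow> \<alpha> i j \<in> A"
  shows "mnorm k (\<lambda>i j. act (\<alpha> i j) y) \<le> fun_mnorm k \<alpha> * mnorm k (\<lambda>i j. if i = j then y else 0)"
proof -
  have zero: "act a 0 = 0" if "a \<in> A" for a
    using act_add_right[OF that, of 0 0] by simp
  have "(\<Sum>r<k. act (\<alpha> i r) (if r = j then y else 0)) = act (\<alpha> i j) y" if "i < k" "j < k" for i j
  proof -
    have "(\<Sum>r<k. act (\<alpha> i r) (if r = j then y else 0)) = (\<Sum>r<k. if r = j then act (\<alpha> i r) y else 0)"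
      by (rule sum.cong) (use that zero assms in auto)
    then show ?thesis using that by simp
  qed
  then have "mnorm k (\<lambda>i j. act (\<alpha> i j) y)
      = mnorm k (\<lambda>i j. \<Sum>r<k. act (\<alpha> i r) (if r = j then y else 0))"
    by (intro mnorm_cong) simp
  also have "\<dots> \<le> fun_mnorm k \<alpha> * mnorm k (\<lambda>i j. if i = j then y else 0)"
    by (rule act_mnorm_le) (rule assms)
  finally show ?thesis .
qed

lemma cc_module_map_diff:
  fixes T :: "'x \<Rightarrow> 'y::ab_group_add"
  assumes "cc_module_map A UNIV act mnorm Y actY normY T"
  shows "T (x - y) = T x - T y"
proof -
  have "T (x - y + y) = T (x - y) + T y" using assms unfolding cc_module_map_def by blast
  then show ?thesis by simp
qed

lemma endo_norm_le:
  assumes "endo T"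
  shows "norm (T x) \<le> norm x"
proof -
  have "mnorm 1 (\<lambda>_ _. T x) \<le> mnorm 1 (\<lambda>_ _. x)"
    by (rule cc_module_map_norm_le[OF assms]) simp
  then show ?thesis by (simp only: mnorm_1)
qed

lemma continuous_endo:
  assumes "endo T"
  shows "continuous_on UNIV T"
proof -
  have "dist (T x) (T y) \<le> 1 * dist x y" for x y
    using endo_norm_le[OF assms, of "x - y"] by (simp add: dist_norm cc_module_map_diff[OF assms])
  then have "1-lipschitz_on UNIV T" by (simp add: lipschitz_on_def)
  then show ?thesis by (rule lipschitz_on_continuous_on)
qed

lemma endo_comp:
  assumes "row_map n \<phi>" "row_comap n \<psi>"
  shows "endo (\<lambda>x. \<psi> (\<phi> x))"
  unfolding cc_module_map_def
proof (intro conjI allI impI)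
  fix k :: nat and u :: "nat \<Rightarrow> nat \<Rightarrow> 'x"
  have mem: "\<phi> x \<in> row_space A n" for x using assms(1) unfolding cc_module_map_def by blast
  have "mnorm k (\<lambda>i j. \<psi> (\<phi> (u i j))) \<le> row_mnorm n k (\<lambda>i j. \<phi> (u i j))"
    by (rule cc_module_map_norm_le[OF assms(2)]) (rule mem)
  also have "\<dots> \<le> mnorm k u"
    by (rule cc_module_map_norm_le[OF assms(1)]) simp
  finally show "mnorm k (\<lambda>i j. \<psi> (\<phi> (u i j))) \<le> mnorm k u" .
qed (use assms in \<open>simp_all add: cc_module_map_def\<close>)

lemma row_map_comp_endo:
  assumes "row_map n \<phi>" "endo T"
  shows "row_map n (\<lambda>x. \<phi> (T x))"
  unfolding cc_module_map_def
proof (intro conjI allI impI)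
  fix k :: nat and u :: "nat \<Rightarrow> nat \<Rightarrow> 'x"
  have "row_mnorm n k (\<lambda>i j. \<phi> (T (u i j))) \<le> mnorm k (\<lambda>i j. T (u i j))"
    by (rule cc_module_map_norm_le[OF assms(1)]) simp
  also have "\<dots> \<le> mnorm k u"
    by (rule cc_module_map_norm_le[OF assms(2)]) simp
  finally show "row_mnorm n k (\<lambda>i j. \<phi> (T (u i j))) \<le> mnorm k u" .
qed (use assms in \<open>simp_all add: cc_module_map_def\<close>)

lemma row_coordinate_mem:
  assumes "row_map n \<phi>" "l < n"
  shows "\<phi> x l \<in> A"
  using assms unfolding cc_module_map_def row_space_def by blast

text \<open>This is contractivity at the first matrix level. It makes point evaluations of
  coordinates continuous, as the density arguments require.\<close>

lemma row_coordinate_norm_le: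
  assumes "row_map n \<phi>" "l < n"
  shows "cmod (\<phi> x l p) \<le> norm x"
proof -
  have mem: "\<phi> x \<in> row_space A n" using assms(1) unfolding cc_module_map_def by blast
  have "cmod (\<phi> x l p) \<le> op_norm 1 1 (\<lambda>_ _. \<phi> x l p)"
    by (rule norm_entry_le_op_norm)
  also have "\<dots> \<le> fun_mnorm 1 (\<lambda>_ _. \<phi> x l)"
    unfolding fun_mnorm_def
    by (rule cSUP_upper[OF _ bdd_above_op_norm])
      (use row_coordinate_mem[OF assms] in auto)
  also have "\<dots> \<le> row_mnorm n 1 (\<lambda>_ _. \<phi> x)"
    using fun_mnorm_coordinate_le_row_mnorm[OF assms(2), of 1 "\<lambda>_ _. \<phi> x"] mem by simp
  also have "\<dots> \<le> mnorm 1 (\<lambda>_ _. x)"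
    by (rule cc_module_map_norm_le[OF assms(1)]) simp
  finally show ?thesis by (simp only: mnorm_1)
qed

lemma continuous_row_coordinate:
  assumes "row_map n \<phi>" "l < n"
  shows "continuous_on UNIV (\<lambda>x. \<phi> x l p)"
proof -
  have "dist (\<phi> x l p) (\<phi> y l p) \<le> 1 * dist x y" for x y
    using row_coordinate_norm_le[OF assms, of "x - y" p]
    by (simp add: dist_norm cc_module_map_diff[OF assms(1)])
  then have "1-lipschitz_on UNIV (\<lambda>x. \<phi> x l p)" by (simp add: lipschitz_on_def)
  then show ?thesis by (rule lipschitz_on_continuous_on)
qed

lemma row_coordinate_act:
  assumes "row_map n \<phi>" "a \<in> A"
  shows "\<phi> (act a x) l p = a p * \<phi> x l p"
  using assms unfolding cc_module_map_def row_act_def by simp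

text \<open>The tuple is a combination of standard basis tuples. Since \<psi> is known to be
  additive only on \<open>row_space A n\<close>, the sum is built one coordinate at a time inside
  that space.\<close>

lemma row_comap_expand:
  assumes "row_comap n \<psi>" "v \<in> row_space A n"
  shows "\<psi> v = (\<Sum>l<n. act (v l) (\<psi> (\<lambda>i. if i = l then 1 else 0)))"
proof -
  define e :: "nat \<Rightarrow> nat \<Rightarrow> 't \<Rightarrow> complex" where "e l = (\<lambda>i. if i = l then 1 else 0)" for l
  have v: "v l \<in> A" if "l < n" for l using assms(2) that by (simp add: row_space_def)
  have add: "\<psi> (x + y) = \<psi> x + \<psi> y" if "x \<in> row_space A n" "y \<in> row_space A n" for x y
    using assms(1) that unfolding cc_module_map_def by blast
  have e_mem: "e l \<in> row_space A n" if "l < n" for l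
    using that zero_mem one_mem by (auto simp: row_space_def e_def)
  have act_mem: "row_act (v l) (e l) \<in> row_space A n" if "l < n" for l
    using that e_mem[OF that] v[OF that] by (auto simp: row_space_def row_act_def intro: mult_mem)
  have zero: "0 \<in> row_space A n" using zero_mem by (simp add: row_space_def)
  have psi0: "\<psi> 0 = 0" using add[OF zero zero] by simp
  \<comment> \<open>Truncation to the first \<open>m\<close> coordinates, leading from 0 at
    \<open>m = 0\<close> to \<open>v\<close> at \<open>m = n\<close>.\<close>
  define t where "t m = (\<lambda>i. if i < m then v i else 0)" for m
  have t_mem: "t m \<in> row_space A n" if "m \<le> n" for m
    using that v zero_mem by (auto simp: row_space_def t_def)
  have "\<psi> (t m) = (\<Sum>l<m. act (v l) (\<psi> (e l)))" if "m \<le> n" for m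
    using that
  proof (induction m)
    case 0
    have "t 0 = 0" by (auto simp: t_def)
    then show ?case by (simp only: psi0 lessThan_0 sum.empty)
  next
    case (Suc m)
    then have m: "m < n" by simp
    have "t (Suc m) = t m + row_act (v m) (e m)"
      by (auto simp: t_def row_act_def e_def fun_eq_iff less_Suc_eq)
    then have "\<psi> (t (Suc m)) = \<psi> (t m) + \<psi> (row_act (v m) (e m))"
      using add t_mem act_mem m by simp
    also have "\<psi> (row_act (v m) (e m)) = act (v m) (\<psi> (e m))"
      using assms(1) v[OF m] e_mem[OF m] unfolding cc_module_map_def by blast
    finally show ?case using Suc m by simp
  qed
  moreover have "t n = v" using assms(2) by (auto simp: t_def row_space_def)
  ultimately show ?thesis unfolding e_def by fastforce
qed

text \<open>A map that factors through a row module is governed by finitely many vectors, the images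
  of the standard basis, and \<open>S\<close> acts on these alone.\<close>

lemma endo_comp_comap_expand:
  assumes "row_map n \<phi>" "row_comap n \<psi>" "endo S"
  shows "S (\<psi> (\<phi> z)) = (\<Sum>l<n. act (\<phi> z l) (S (\<psi> (\<lambda>i. if i = l then 1 else 0))))"
proof -
  have mem: "\<phi> z \<in> row_space A n" using assms(1) unfolding cc_module_map_def by blast
  have S0: "S 0 = 0" using cc_module_map_diff[OF assms(3), of 0 0] by simp
  have Sadd: "S (x + y) = S x + S y" for x y using assms(3) unfolding cc_module_map_def by blast
  have Sact: "S (act a x) = act a (S x)" if "a \<in> A" for a x
    using assms(3) that unfolding cc_module_map_def by blast
  have "S (\<Sum>l\<in>L. f l) = (\<Sum>l\<in>L. S (f l))" for L and f :: "nat \<Rightarrow> 'x"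
    by (induction L rule: infinite_finite_induct) (simp_all add: S0 Sadd)
  then show ?thesis
    using row_comap_expand[OF assms(2) mem] row_coordinate_mem[OF assms(1)] by (simp add: Sact)
qed

text \<open>Each summand of the expansion multiplies a fixed vector by a completely contractive
  coordinate, so it costs at most the norm of that vector. Convergence in completely bounded norm is
  thereby reduced to norm convergence at finitely many vectors.\<close>

lemma cb_norm_le_sum:
  assumes \<phi>: "row_map n \<phi>" and \<psi>: "row_comap n \<psi>" and S: "endo S"
  shows "cb_norm UNIV mnorm (row_mnorm n) (\<lambda>z. \<phi> (S (\<psi> (\<phi> z)) - \<psi> (\<phi> z)))
    \<le> ennreal (\<Sum>l<n. norm (S (\<psi> (\<lambda>i. if i = l then 1 else 0)) - \<psi> (\<lambda>i. if i = l then 1 else 0)))"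
  unfolding cb_norm_def
proof (intro SUP_least ennreal_leI)
  define y where "y l = S (\<psi> (\<lambda>i. if i = l then 1 else 0)) - \<psi> (\<lambda>i. if i = l then 1 else 0)" for l
  fix k u assume "u \<in> {u. (\<forall>i<k. \<forall>j<k. u i j \<in> (UNIV :: 'x set)) \<and> mnorm k u \<le> 1}"
  then have u: "mnorm k u \<le> 1" by simp
  \<comment> \<open>With the identity as endomorphism, the expansion covers
    \<open>\<psi> (\<phi> z)\<close> itself.\<close>
  have id: "endo (\<lambda>x. x)" by (simp add: cc_module_map_def)
  have diff: "act a x - act a x' = act a (x - x')" if "a \<in> A" for a x x'
    using act_add_right[OF that, of "x - x'" x'] by simp
  have "S (\<psi> (\<phi> z)) - \<psi> (\<phi> z) = (\<Sum>l<n. act (\<phi> z l) (y l))" for z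
    unfolding y_def
    using arg_cong2[where f = minus, OF endo_comp_comap_expand[OF \<phi> \<psi> S, of z]
        endo_comp_comap_expand[OF \<phi> \<psi> id, of z]]
    by (simp add: row_coordinate_mem[OF \<phi>] diff flip: sum_subtractf)
  then have "row_mnorm n k (\<lambda>i j. \<phi> (S (\<psi> (\<phi> (u i j))) - \<psi> (\<phi> (u i j))))
      = row_mnorm n k (\<lambda>i j. \<phi> (\<Sum>l<n. act (\<phi> (u i j) l) (y l)))"
    by simp
  also have "\<dots> \<le> mnorm k (\<lambda>i j. \<Sum>l<n. act (\<phi> (u i j) l) (y l))"
    by (rule cc_module_map_norm_le[OF \<phi>]) simp
  also have "\<dots> \<le> (\<Sum>l<n. mnorm k (\<lambda>i j. act (\<phi> (u i j) l) (y l)))"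
    by (rule mnorm_sum_le)
  also have "\<dots> \<le> (\<Sum>l<n. norm (y l))"
  proof (rule sum_mono)
    fix l assume "l \<in> {..<n}"
    then have l: "l < n" by simp
    have "fun_mnorm k (\<lambda>i j. \<phi> (u i j) l) \<le> row_mnorm n k (\<lambda>i j. \<phi> (u i j))"
      by (rule fun_mnorm_coordinate_le_row_mnorm[OF l])
        (rule cc_module_map_mem[OF \<phi> UNIV_I])
    also have "\<dots> \<le> mnorm k u" by (rule cc_module_map_norm_le[OF \<phi>]) simp
    finally have c: "fun_mnorm k (\<lambda>i j. \<phi> (u i j) l) \<le> 1" using u by simp
    \<comment> \<open>Nonnegativity comes from the triangle inequality for \<open>w\<close> and its
      negative, whose sum has norm 0.\<close>
    have pos: "0 \<le> mnorm k w" for w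
      using mnorm_triangle[of k w "\<lambda>i j. scaleC (-1) (w i j)"] mnorm_scale[of k "-1" w]
        mnorm_eq_0_iff[of k "\<lambda>_ _. 0"] by simp
    have "mnorm k (\<lambda>i j. act (\<phi> (u i j) l) (y l))
        \<le> fun_mnorm k (\<lambda>i j. \<phi> (u i j) l) * mnorm k (\<lambda>i j. if i = j then y l else 0)"
      by (rule mnorm_act_le) (rule row_coordinate_mem[OF \<phi> l])
    also have "\<dots> \<le> 1 * mnorm k (\<lambda>i j. if i = j then y l else 0)"
      by (rule mult_right_mono[OF c pos])
    also have "\<dots> \<le> norm (y l)" using mnorm_diagonal_le by simp
    finally show "mnorm k (\<lambda>i j. act (\<phi> (u i j) l) (y l)) \<le> norm (y l)" .
  qed
  finally show "row_mnorm n k (\<lambda>i j. \<phi> (S (\<psi> (\<phi> (u i j))) - \<psi> (\<phi> (u i j))))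
      \<le> (\<Sum>l<n. norm (S (\<psi> (\<lambda>i. if i = l then 1 else 0)) - \<psi> (\<lambda>i. if i = l then 1 else 0)))"
    unfolding y_def .
qed

section \<open>Singly generated modules\<close>

text \<open>Equalizers of continuous maps into a Hausdorff space are closed, so an identity need
  only be checked on multiples of the generator.\<close>

lemma eq_of_eq_on_orbit:
  fixes f g :: "'x \<Rightarrow> 'b::t2_space"
  assumes gen: "closure ((\<lambda>a. act a x) ` A) = UNIV"
    and "continuous_on UNIV f" "continuous_on UNIV g"
    and "\<And>a. a \<in> A \<Longrightarrow> f (act a x) = g (act a x)"
  shows "f y = g y"
proof -
  have "closed {y. f y = g y}" using assms(2,3) by (rule closed_Collect_eq)
  then have "closure ((\<lambda>a. act a x) ` A) \<subseteq> {y. f y = g y}"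
    by (rule closure_minimal[rotated]) (use assms(4) in auto)
  then show ?thesis using gen by auto
qed

text \<open>Everything is evaluated at a fixed point \<open>p\<close>, so that cancelling the
  coordinate of the generator is division by a nonzero complex number.\<close>

lemma row_coordinate_commute:
  assumes gen: "closure ((\<lambda>a. act a x) ` A) = UNIV"
    and \<phi>: "row_map n \<phi>" and l: "l < n" and S: "endo S" and T: "endo T"
  shows "\<phi> (S (T x)) l p = \<phi> (T (S x)) l p"
proof -
  note cont = continuous_row_coordinate[OF \<phi> l, of p]
  have Tact: "T (act a y) = act a (T y)" if "endo T" "a \<in> A" for T a y
    using that unfolding cc_module_map_def by blast
  \<comment> \<open>At \<open>y = act a x\<close> both sides equal
    \<open>a p * \<phi> (T x) l p * \<phi> x l p\<close>.\<close>
  have swap: "\<phi> (T y) l p * \<phi> x l p = \<phi> y l p * \<phi> (T x) l p" if T: "endo T" for T y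
  proof (rule eq_of_eq_on_orbit[OF gen, where f = "\<lambda>y. \<phi> (T y) l p * \<phi> x l p"
        and g = "\<lambda>y. \<phi> y l p * \<phi> (T x) l p"])
    show "continuous_on UNIV (\<lambda>y. \<phi> (T y) l p * \<phi> x l p)"
      by (intro continuous_intros continuous_on_compose2[OF cont continuous_endo[OF T]]) auto
    show "continuous_on UNIV (\<lambda>y. \<phi> y l p * \<phi> (T x) l p)"
      by (intro continuous_intros cont)
    show "\<phi> (T (act a x)) l p * \<phi> x l p = \<phi> (act a x) l p * \<phi> (T x) l p" if "a \<in> A" for a
      using that by (simp add: Tact[OF T] row_coordinate_act[OF \<phi>])
  qed
  show ?thesis
  proof (cases "\<phi> x l p = 0")
    case True
    \<comment> \<open>The coordinate vanishes at \<open>p\<close> on all multiples of the generator,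
      hence by density everywhere.\<close>
    have "\<phi> y l p = 0" for y
      by (rule eq_of_eq_on_orbit[OF gen, where f = "\<lambda>y. \<phi> y l p" and g = "\<lambda>_. 0"])
        (use cont True in \<open>auto simp: row_coordinate_act[OF \<phi>]\<close>)
    then show ?thesis by simp
  next
    case False
    \<comment> \<open>By \<open>swap\<close>, both sides equal the product of
      \<open>\<phi> (S x) l p\<close> and \<open>\<phi> (T x) l p\<close>.\<close>
    have "\<phi> (S (T x)) l p * \<phi> x l p = \<phi> (T (S x)) l p * \<phi> x l p"
      using swap[OF S, of "T x"] swap[OF T, of "S x"] by (simp add: mult.commute)
    then show ?thesis using False by simp
  qed
qed

text \<open>The net reconstructs every element from its rows in the limit, so equality of all
  coordinates suffices at the generator; density then spreads the identity to all of the
  module.\<close>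

lemma endo_commute:
  assumes gen: "closure ((\<lambda>a. act a x) ` A) = UNIV"
    and net: "hilbertian_net A mnorm act I le t" and S: "endo S" and T: "endo T"
  shows "S (T y) = T (S y)"
proof -
  have dir: "directed I le" using net by (simp add: hilbertian_net_def)
  have row: "to_row (t \<alpha>) (S (T x)) = to_row (t \<alpha>) (T (S x))" if "\<alpha> \<in> I" for \<alpha>
  proof -
    have m: "row_map (row_dim (t \<alpha>)) (to_row (t \<alpha>))"
      using net that by (simp add: hilbertian_net_def cc_factorization_def)
    have z: "to_row (t \<alpha>) y l = 0" if "l \<ge> row_dim (t \<alpha>)" for y l
      using m that unfolding cc_module_map_def row_space_def by blast
    show ?thesis
    proof (intro ext)
      show "to_row (t \<alpha>) (S (T x)) l p = to_row (t \<alpha>) (T (S x)) l p" for l p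
        using z row_coordinate_commute[OF gen m _ S T] by (cases "l < row_dim (t \<alpha>)") auto
    qed
  qed
  have lim: "((\<lambda>\<alpha>. from_row (t \<alpha>) (to_row (t \<alpha>) y)) \<longlongrightarrow> y) (along I le)" for y
    using net by (simp add: hilbertian_net_def)
  have ev: "\<forall>\<^sub>F \<alpha> in along I le. from_row (t \<alpha>) (to_row (t \<alpha>) (S (T x)))
      = from_row (t \<alpha>) (to_row (t \<alpha>) (T (S x)))"
    using eventually_along_mem[OF dir] by eventually_elim (simp only: row)
  have x: "S (T x) = T (S x)"
    using along_neq_bot[OF dir] Lim_transform_eventually[OF lim ev] lim by (rule tendsto_unique)
  show ?thesis
  proof (rule eq_of_eq_on_orbit[OF gen, where f = "\<lambda>y. S (T y)" and g = "\<lambda>y. T (S y)"])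
    show "continuous_on UNIV (\<lambda>y. S (T y))" "continuous_on UNIV (\<lambda>y. T (S y))"
      using continuous_on_compose2[OF continuous_endo continuous_endo] S T by auto
    show "S (T (act a x)) = T (S (act a x))" if "a \<in> A" for a
      using S T x that unfolding cc_module_map_def by simp
  qed
qed

text \<open>The factor \<open>T \<beta>\<close> inserted in the modified map is what makes
  \<open>cb_norm_le_sum\<close> applicable: it confines the difference of \<open>T \<alpha>\<close>
  squared and the identity to finitely many vectors.\<close>

lemma rigged_if_hilbertian:
  assumes "singly_generated A act" and "hilbertian A mnorm act"
  shows "rigged A mnorm act"
proof -
  obtain x where gen: "closure ((\<lambda>a. act a x) ` A) = UNIV"
    using assms(1) unfolding singly_generated_def by blast
  obtain I :: "('t, 'x) net_index set" and le t where net: "hilbertian_net A mnorm act I le t"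
    using assms(2) unfolding hilbertian_def by blast
  define T where "T = (\<lambda>\<alpha> y. from_row (t \<alpha>) (to_row (t \<alpha>) y))"
  define s where "s \<alpha> = (row_dim (t \<alpha>), \<lambda>y. to_row (t \<alpha>) (T \<alpha> y), from_row (t \<alpha>))" for \<alpha>
  have s: "row_dim (s \<alpha>) = row_dim (t \<alpha>)" "to_row (s \<alpha>) = (\<lambda>y. to_row (t \<alpha>) (T \<alpha> y))"
    "from_row (s \<alpha>) = from_row (t \<alpha>)" for \<alpha>
    by (simp_all add: s_def row_dim_def to_row_def from_row_def)
  have dir: "directed I le" using net by (simp add: hilbertian_net_def)
  have dim: "row_dim (t \<alpha>) > 0" and rmap: "row_map (row_dim (t \<alpha>)) (to_row (t \<alpha>))"
    and comap: "row_comap (row_dim (t \<alpha>)) (from_row (t \<alpha>))" if "\<alpha> \<in> I" for \<alpha>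
    using net that by (simp_all add: hilbertian_net_def cc_factorization_def)
  have T: "endo (T \<alpha>)" if "\<alpha> \<in> I" for \<alpha>
    unfolding T_def using rmap[OF that] comap[OF that] by (rule endo_comp)
  have TT: "endo (\<lambda>y. T \<alpha> (T \<alpha> y))" if "\<alpha> \<in> I" for \<alpha>
    using row_map_comp_endo[OF rmap[OF that] T[OF that]] comap[OF that]
    unfolding T_def by (rule endo_comp)
  note I_ev = eventually_along_mem[OF dir]
  have limT: "((\<lambda>\<alpha>. T \<alpha> y) \<longlongrightarrow> y) (along I le)" for y
    using net unfolding T_def by (simp add: hilbertian_net_def)
  have limTT: "((\<lambda>\<alpha>. T \<alpha> (T \<alpha> y)) \<longlongrightarrow> y) (along I le)" for y
  proof -
    \<comment> \<open>Contractivity of \<open>T \<alpha>\<close> keeps the error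
      \<open>T \<alpha> y - y\<close> null after one more application.\<close>
    have "((\<lambda>\<alpha>. T \<alpha> (T \<alpha> y - y)) \<longlongrightarrow> 0) (along I le)"
    proof (rule Lim_null_comparison)
      show "\<forall>\<^sub>F \<alpha> in along I le. norm (T \<alpha> (T \<alpha> y - y)) \<le> norm (T \<alpha> y - y)"
        using I_ev by eventually_elim (rule endo_norm_le[OF T])
      show "((\<lambda>\<alpha>. norm (T \<alpha> y - y)) \<longlongrightarrow> 0) (along I le)"
        using limT[of y] by (simp add: LIM_zero tendsto_norm_zero)
    qed
    from tendsto_add[OF this limT[of y]]
    have "((\<lambda>\<alpha>. T \<alpha> (T \<alpha> y - y) + T \<alpha> y) \<longlongrightarrow> y) (along I le)" by simp
    moreover have "\<forall>\<^sub>F \<alpha> in along I le. T \<alpha> (T \<alpha> y - y) + T \<alpha> y = T \<alpha> (T \<alpha> y)"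
      using I_ev by eventually_elim (simp add: cc_module_map_diff[OF T])
    ultimately show ?thesis by (rule Lim_transform_eventually)
  qed
  have "hilbertian_net A mnorm act I le s"
    unfolding hilbertian_net_def cc_factorization_def s
  proof (intro conjI ballI allI)
    show "row_map (row_dim (t \<alpha>)) (\<lambda>y. to_row (t \<alpha>) (T \<alpha> y))" if "\<alpha> \<in> I" for \<alpha>
      using rmap[OF that] T[OF that] by (rule row_map_comp_endo)
    show "((\<lambda>\<alpha>. from_row (t \<alpha>) (to_row (t \<alpha>) (T \<alpha> y))) \<longlongrightarrow> y) (along I le)" for y
      using limTT[of y] unfolding T_def .
  qed (fact dir dim comap)+
  moreover have "((\<lambda>\<alpha>. cb_norm UNIV mnorm (row_mnorm (row_dim (s \<beta>)))
          (\<lambda>z. to_row (s \<beta>) (from_row (s \<alpha>) (to_row (s \<alpha>) z)) - to_row (s \<beta>) z))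
        \<longlongrightarrow> 0) (along I le)" if \<beta>: "\<beta> \<in> I" for \<beta>
  proof -
    \<comment> \<open>These vectors depend on \<open>\<beta>\<close> only, so \<open>limTT\<close>
      makes the finite sum \<open>C \<alpha>\<close> tend to 0.\<close>
    define b where "b l = from_row (t \<beta>) (\<lambda>i. if i = l then 1 else 0)" for l :: nat
    define C where "C \<alpha> = (\<Sum>l<row_dim (t \<beta>). norm (T \<alpha> (T \<alpha> (b l)) - b l))" for \<alpha>
    have C: "((\<lambda>\<alpha>. ennreal (C \<alpha>)) \<longlongrightarrow> ennreal 0) (along I le)"
      unfolding C_def
      by (intro tendsto_ennrealI tendsto_null_sum tendsto_norm_zero LIM_zero limTT)
    have "\<forall>\<^sub>F \<alpha> in along I le. cb_norm UNIV mnorm (row_mnorm (row_dim (s \<beta>)))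
          (\<lambda>z. to_row (s \<beta>) (from_row (s \<alpha>) (to_row (s \<alpha>) z)) - to_row (s \<beta>) z) \<le> ennreal (C \<alpha>)"
      using I_ev
    proof eventually_elim
      case (elim \<alpha>)
      \<comment> \<open>Commutativity moves \<open>T \<beta>\<close> from the left of the square of
        \<open>T \<alpha>\<close> to its right, which is the form that \<open>cb_norm_le_sum\<close>
        bounds.\<close>
      have "to_row (s \<beta>) (from_row (s \<alpha>) (to_row (s \<alpha>) z)) - to_row (s \<beta>) z
          = to_row (t \<beta>) (T \<alpha> (T \<alpha> (T \<beta> z)) - T \<beta> z)" for z
        using endo_commute[OF gen net T[OF \<beta>] TT[OF elim]]
        unfolding s cc_module_map_diff[OF rmap[OF \<beta>]] by (simp add: T_def)
      then show ?case
        using cb_norm_le_sum[OF rmap[OF \<beta>] comap[OF \<beta>] TT[OF elim]]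
        by (simp add: C_def b_def s T_def)
    qed
    from this C[unfolded ennreal_0] show ?thesis
      by (rule tendsto_sandwich[OF always_eventually _ tendsto_const, rotated]) simp
  qed
  ultimately have "rigged_net A mnorm act I le s"
    unfolding rigged_net_def by blast
  then show ?thesis unfolding rigged_def by blast
qed

end

theorem corollary8p5:
  fixes A :: "('t::t2_space \<Rightarrow> complex) set"
    and scaleC :: "complex \<Rightarrow> 'x::banach \<Rightarrow> 'x"
    and mnorm :: "nat \<Rightarrow> (nat \<Rightarrow> nat \<Rightarrow> 'x) \<Rightarrow> real"
    and act :: "('t \<Rightarrow> complex) \<Rightarrow> 'x \<Rightarrow> 'x"
  assumes "operator_module A scaleC mnorm act"
    and "singly_generated A act"
  shows "hilbertian A mnorm act \<longleftrightarrow> rigged A mnorm act"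
proof
  assume "hilbertian A mnorm act"
  with assms show "rigged A mnorm act" by (rule operator_module.rigged_if_hilbertian)
next
  assume "rigged A mnorm act"
  then show "hilbertian A mnorm act"
    unfolding rigged_def hilbertian_def rigged_net_def by blast
qed

end
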